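(* ($N$-bright soliton solution.) Let $\sigma=\pm1$, let $\lambda_1,\dots,\lambda_N\in\mathbb C\setminus(\mathbb R\cup\mathrm i\mathbb R)$ with $\lambda_i^2\ne\lambda_j^2$ for $i\neq j$, put $z_i=\lambda_i^{-2}=z_{i,R}+\mathrm iz_{i,I}$ and assume $z_{i,I}<0$. Let $c_{i,1},c_{i,2}\in\mathbb C$, $\theta_i=\mathrm i\big(z_ix+\frac{1}{4z_i}t\big)$, $\gamma_{i,j}=-(c_{i,1}^*c_{j,1}+\sigma c_{i,2}^*c_{j,2})$, $$m_{i,j}=\frac{2z_i^*z_j}{z_j-z_i^*}\Big[\lambda_j\mathrm e^{\theta_i^*+\theta_j}+\lambda_i^*\gamma_{i,j}\mathrm e^{-\theta_i^*-\theta_j}\Big],\quad M=(m_{i,j})_{1\le i,j\le N},$$ $Y_1=(\mathrm e^{\theta_1},\dots,\mathrm e^{\theta_N})$ and $Y_2^{[s]}=(c_{1,s}\mathrm e^{-\theta_1},\dots,c_{N,s}\mathrm e^{-\theta_N})$ for $s=1,2$. Then, wherever $\det M\ne0$, the functions $$u_s[N]=-2\,\frac{\det\begin{pmatrix}M&Y_1^\dagger\\ Y_2^{[s]}&0\end{pmatrix}}{\det M},\qquad s=1,2,$$ solve the coupled Fokas–Lenells equation $$u_{1,xt}+u_1+\mathrm i(|u_1|^2+\tfrac12\sigma|u_2|^2)u_{1,x}+\tfrac{\mathrm i}{2}\sigma u_1u_2^*u_{2,x}=0,\qquad u_{2,xt}+u_2+\mathrm i(\sigma|u_2|^2+\tfrac12|u_1|^2)u_{2,x}+\tfrac{\mathrm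 i}{2}u_2u_1^*u_{1,x}=0.$$
   Context: $^*$ denotes complex conjugation and $^\dagger$ conjugate transpose; $x,t$ are real variables and subscripts $x,t$ after a comma denote partial derivatives. *)

theory Defs
  imports "HOL-Analysis.Derivative" "Jordan_Normal_Form.Determinant"
begin

definition pd_x :: "(real \<Rightarrow> real \<Rightarrow> complex) \<Rightarrow> real \<Rightarrow> real \<Rightarrow> complex" where
  "pd_x u x t = vector_derivative (\<lambda>\<xi>. u \<xi> t) (at x)"

definition pd_t :: "(real \<Rightarrow> real \<Rightarrow> complex) \<Rightarrow> real \<Rightarrow> real \<Rightarrow> complex" where
  "pd_t u x t = vector_derivative (\<lambda>\<tau>. u x \<tau>) (at t)"

text \<open>
  \<^const>\<open>vector_derivative\<close> is total, so the existence of the partial derivatives that occur in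
  the equation is part of the notion of solution; \<open>u\<^sub>x\<^sub>t\<close> is read as the \<open>t\<close>-derivative of \<open>u\<^sub>x\<close>.
\<close>

definition has_pd_x_xt :: "(real \<Rightarrow> real \<Rightarrow> complex) \<Rightarrow> real \<Rightarrow> real \<Rightarrow> bool" where
  "has_pd_x_xt u x t \<longleftrightarrow>
     (\<lambda>\<xi>. u \<xi> t) differentiable (at x) \<and> (\<lambda>\<tau>. pd_x u x \<tau>) differentiable (at t)"

definition solves_coupled_FL ::
  "real \<Rightarrow> (real \<times> real) set \<Rightarrow> (real \<Rightarrow> real \<Rightarrow> complex) \<Rightarrow> (real \<Rightarrow> real \<Rightarrow> complex) \<Rightarrow> bool" where
  "solves_coupled_FL \<sigma> \<Omega> u1 u2 \<longleftrightarrow> (\<forall>(x, t) \<in> \<Omega>.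
     has_pd_x_xt u1 x t \<and> has_pd_x_xt u2 x t \<and>
     pd_t (pd_x u1) x t + u1 x t
       + \<i> * of_real ((cmod (u1 x t))\<^sup>2 + 1/2 * \<sigma> * (cmod (u2 x t))\<^sup>2) * pd_x u1 x t
       + \<i> / 2 * of_real \<sigma> * u1 x t * cnj (u2 x t) * pd_x u2 x t = 0 \<and>
     pd_t (pd_x u2) x t + u2 x t
       + \<i> * of_real (\<sigma> * (cmod (u2 x t))\<^sup>2 + 1/2 * (cmod (u1 x t))\<^sup>2) * pd_x u2 x t
       + \<i> / 2 * u2 x t * cnj (u1 x t) * pd_x u1 x t = 0)"

text \<open>
  The spectral data are \<open>lam i\<close> and \<open>c i s\<close> with \<open>i < N\<close> (indices shifted to start at 0) and
  \<open>s \<in> {1, 2}\<close>.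
\<close>

definition zpar :: "(nat \<Rightarrow> complex) \<Rightarrow> nat \<Rightarrow> complex" where
  "zpar lam i = 1 / (lam i)\<^sup>2"

definition theta :: "(nat \<Rightarrow> complex) \<Rightarrow> nat \<Rightarrow> real \<Rightarrow> real \<Rightarrow> complex" where
  "theta lam i x t = \<i> * (zpar lam i * of_real x + 1 / (4 * zpar lam i) * of_real t)"

definition gam :: "real \<Rightarrow> (nat \<Rightarrow> nat \<Rightarrow> complex) \<Rightarrow> nat \<Rightarrow> nat \<Rightarrow> complex" where
  "gam \<sigma> c i j = - (cnj (c i 1) * c j 1 + of_real \<sigma> * cnj (c i 2) * c j 2)"

definition Mmat :: "nat \<Rightarrow> real \<Rightarrow> (nat \<Rightarrow> complex) \<Rightarrow> (nat \<Rightarrow> nat \<Rightarrow> complex) \<Rightarrow> real \<Rightarrow> real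
    \<Rightarrow> complex mat" where
  "Mmat N \<sigma> lam c x t = mat N N (\<lambda>(i, j).
     2 * cnj (zpar lam i) * zpar lam j / (zpar lam j - cnj (zpar lam i)) *
     (lam j * exp (cnj (theta lam i x t) + theta lam j x t)
      + cnj (lam i) * gam \<sigma> c i j * exp (- cnj (theta lam i x t) - theta lam j x t)))"

definition Y1 :: "nat \<Rightarrow> (nat \<Rightarrow> complex) \<Rightarrow> real \<Rightarrow> real \<Rightarrow> complex mat" where
  "Y1 N lam x t = mat 1 N (\<lambda>(_, i). exp (theta lam i x t))"

definition Y2 :: "nat \<Rightarrow> (nat \<Rightarrow> complex) \<Rightarrow> (nat \<Rightarrow> nat \<Rightarrow> complex) \<Rightarrow> nat \<Rightarrow> real \<Rightarrow> real
    \<Rightarrow> complex mat" where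
  "Y2 N lam c s x t = mat 1 N (\<lambda>(_, i). c i s * exp (- theta lam i x t))"

definition conj_transpose :: "complex mat \<Rightarrow> complex mat" where
  "conj_transpose A = map_mat cnj (transpose_mat A)"

definition bright_soliton :: "nat \<Rightarrow> real \<Rightarrow> (nat \<Rightarrow> complex) \<Rightarrow> (nat \<Rightarrow> nat \<Rightarrow> complex) \<Rightarrow> nat
    \<Rightarrow> real \<Rightarrow> real \<Rightarrow> complex" where
  "bright_soliton N \<sigma> lam c s x t =
     - 2 * (det (four_block_mat (Mmat N \<sigma> lam c x t) (conj_transpose (Y1 N lam x t))
                                (Y2 N lam c s x t)   (0\<^sub>m 1 1))
            / det (Mmat N \<sigma> lam c x t))"

end

theory Submission
  imports Defs "HOL-Analysis.Complex_Transcendental"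
begin

text \<open>
  Write \<open>F v w = v M\<^sup>-\<^sup>1 w\<close>, let \<open>e\<close>, \<open>b\<^sub>1\<close>, \<open>b\<^sub>2\<close> be the rows \<open>Y\<^sub>1\<close>, \<open>Y\<^sub>2\<^sup>[\<^sup>1\<^sup>]\<close>, \<open>Y\<^sub>2\<^sup>[\<^sup>2\<^sup>]\<close>, \<open>e\<^sup>*\<close> the column
  conjugate to \<open>e\<close>, and \<open>L\<close> the diagonal matrix of the spectral parameters. Expanding the bordered
  determinant gives \<open>u\<^sub>s = 2 F b\<^sub>s e\<^sup>*\<close>.

  The matrix \<open>M\<close> satisfies Sylvester equations whose right-hand sides are sums of rank one matrices
  built from \<open>e\<close> and the \<open>b\<^sub>s\<close>: one for \<open>L\<^sup>*\<^sup>2 M - M L\<^sup>2\<close>, one for \<open>L\<^sup>* M + M\<^sup>* L\<close> and one for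
  \<open>M L + L\<^sup>* M\<^sup>*\<close>. Sandwiching them between inverses turns them into bilinear relations between values
  of \<open>F\<close>. Since \<open>M\<^sub>x\<close> and \<open>M\<^sub>t\<close> are sums of rank one matrices too, the relations of the first kind give
  \<open>u\<^sub>s\<^sub>,\<^sub>x = - 4 \<i> w\<^sub>s p\<close> with \<open>w\<^sub>s = F b\<^sub>s (L\<^sup>*\<^sup>-\<^sup>2 e\<^sup>*)\<close> and \<open>p = 1 + 2 F (e L\<^sup>-\<^sup>1) e\<^sup>*\<close>, as well as closed formulas
  for the \<open>t\<close>-derivatives of \<open>w\<^sub>s\<close> and \<open>p\<close>. The relations between \<open>M\<close> and its adjoint yield
  \<open>\<bar>p\<bar> = 1\<close> and an expression for \<open>u\<^sub>1\<^sup>* w\<^sub>1 + \<sigma> u\<^sub>2\<^sup>* w\<^sub>2\<close>, which is what the equation reduces to.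
\<close>

section \<open>Bilinear forms in the inverse of a matrix\<close>

text \<open>The inverse is taken as adjugate over determinant, with the indices of the cofactor
  swapped. From this explicit quotient differentiability in a parameter can be read off.\<close>

definition inv_entry :: "'a::field mat \<Rightarrow> nat \<Rightarrow> nat \<Rightarrow> 'a" where
  "inv_entry A i j = cofactor A j i / det A"

definition sandwich :: "nat \<Rightarrow> (nat \<Rightarrow> nat \<Rightarrow> 'a::comm_ring_1) \<Rightarrow> (nat \<Rightarrow> 'a) \<Rightarrow> (nat \<Rightarrow> 'a) \<Rightarrow> 'a" where
  "sandwich n G v w = (\<Sum>i<n. \<Sum>j<n. v i * G i j * w j)"

text \<open>Each triple holds a scalar, a column and a row. A list of them covers the one, two and
  three term right-hand sides of the Sylvester equations and also the derivatives of
  \<open>M\<close>.\<close>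

definition sum_rank_one :: "('a \<times> (nat \<Rightarrow> 'a) \<times> (nat \<Rightarrow> 'a)) list \<Rightarrow> nat \<Rightarrow> nat \<Rightarrow> 'a::comm_ring_1" where
  "sum_rank_one ps i j = (\<Sum>(k, a, b)\<leftarrow>ps. k * a i * b j)"

lemma inv_entry_mult_left:
  assumes "A \<in> carrier_mat n n" "det A \<noteq> 0" "i < n" "j < n"
  shows "(\<Sum>k<n. inv_entry A i k * A $$ (k, j)) = of_bool (i = j)"
proof -
  have "(adj_mat A * A) $$ (i, j) = (\<Sum>k<n. cofactor A k i * A $$ (k, j))"
    using assms by (simp add: times_mat_def scalar_prod_def adj_mat_def atLeast0LessThan)
  then have "(\<Sum>k<n. cofactor A k i * A $$ (k, j)) = det A * of_bool (i = j)"
    using assms by (auto simp: adj_mat(3) split: if_splits)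
  then show ?thesis
    using assms by (cases "i = j") (simp_all add: inv_entry_def flip: sum_divide_distrib)
qed

lemma inv_entry_mult_right:
  assumes "A \<in> carrier_mat n n" "det A \<noteq> 0" "i < n" "j < n"
  shows "(\<Sum>k<n. A $$ (i, k) * inv_entry A k j) = of_bool (i = j)"
proof -
  have "(A * adj_mat A) $$ (i, j) = (\<Sum>k<n. A $$ (i, k) * cofactor A j k)"
    using assms by (simp add: times_mat_def scalar_prod_def adj_mat_def atLeast0LessThan)
  then have "(\<Sum>k<n. A $$ (i, k) * cofactor A j k) = det A * of_bool (i = j)"
    using assms by (auto simp: adj_mat(2) split: if_splits)
  then show ?thesis
    using assms by (cases "i = j") (simp_all add: inv_entry_def flip: sum_divide_distrib)
qed

lemma row_inverse_mult:
  fixes n :: nat and A G :: "nat \<Rightarrow> nat \<Rightarrow> 'a::comm_ring_1"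
  assumes inv: "\<And>i j. i < n \<Longrightarrow> j < n \<Longrightarrow> (\<Sum>k<n. G i k * A k j) = of_bool (i = j)" and "j < n"
  shows "(\<Sum>i<n. (\<Sum>l<n. v l * G l i) * A i j) = v j"
proof -
  have "(\<Sum>i<n. (\<Sum>l<n. v l * G l i) * A i j) = (\<Sum>l<n. v l * (\<Sum>i<n. G l i * A i j))"
    unfolding sum_distrib_left sum_distrib_right by (subst sum.swap) (simp add: mult.assoc)
  also have "\<dots> = (\<Sum>l<n. v l * of_bool (l = j))"
    using assms by simp
  finally show ?thesis
    using \<open>j < n\<close> by (simp add: sum_mult_of_bool_eq)
qed

lemma mult_col_inverse:
  fixes n :: nat and A G :: "nat \<Rightarrow> nat \<Rightarrow> 'a::comm_ring_1"
  assumes inv: "\<And>i j. i < n \<Longrightarrow> j < n \<Longrightarrow> (\<Sum>k<n. A i k * G k j) = of_bool (i = j)" and "i < n"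
  shows "(\<Sum>j<n. A i j * (\<Sum>m<n. G j m * w m)) = w i"
proof -
  have "(\<Sum>j<n. A i j * (\<Sum>m<n. G j m * w m)) = (\<Sum>m<n. (\<Sum>j<n. A i j * G j m) * w m)"
    unfolding sum_distrib_left sum_distrib_right by (subst sum.swap) (simp add: mult.assoc)
  also have "\<dots> = (\<Sum>m<n. of_bool (i = m) * w m)"
    using assms by simp
  finally show ?thesis
    using \<open>i < n\<close> by (simp add: sum_of_bool_mult_eq)
qed

text \<open>Schur complement: with \<open>y\<close> the column \<open>inv_entry A\<close> times
  \<open>w\<close> and \<open>s = v y\<close>, the bordered matrix is the product of the block
  triangular matrices with rows \<open>(A, 0)\<close>, \<open>(v, 1)\<close> and
  \<open>(1, y)\<close>, \<open>(0, - s)\<close>.\<close>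

lemma det_bordered:
  fixes A :: "'a::field mat"
  assumes A: "A \<in> carrier_mat n n" and "det A \<noteq> 0"
  shows "det (four_block_mat A (mat n 1 (\<lambda>(i, _). w i)) (mat 1 n (\<lambda>(_, j). v j)) (0\<^sub>m 1 1))
           = - det A * sandwich n (inv_entry A) v w"
proof -
  let ?v = "mat 1 n (\<lambda>(_, j). v j)" and ?w = "mat n 1 (\<lambda>(i, _). w i)"
  define y where "y = (\<lambda>i. \<Sum>j<n. inv_entry A i j * w j)"
  let ?y = "mat n 1 (\<lambda>(i, _). y i)"
  let ?s = "sandwich n (inv_entry A) v w"
  have Ay: "(\<Sum>j<n. A $$ (i, j) * y j) = w i" if "i < n" for i
    unfolding y_def using inv_entry_mult_right [OF assms] that by (rule mult_col_inverse)
  have s: "(\<Sum>j<n. v j * y j) = ?s"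
    by (simp add: y_def sandwich_def sum_distrib_left mult.assoc)
  have "four_block_mat A (0\<^sub>m n 1) ?v (1\<^sub>m 1) * four_block_mat (1\<^sub>m n) ?y (0\<^sub>m 1 n) (mat 1 1 (\<lambda>_. - ?s))
      = four_block_mat (A * 1\<^sub>m n + 0\<^sub>m n 1 * 0\<^sub>m 1 n) (A * ?y + 0\<^sub>m n 1 * mat 1 1 (\<lambda>_. - ?s))
          (?v * 1\<^sub>m n + 1\<^sub>m 1 * 0\<^sub>m 1 n) (?v * ?y + 1\<^sub>m 1 * mat 1 1 (\<lambda>_. - ?s))"
    using A by (intro mult_four_block_mat) auto
  also have "A * 1\<^sub>m n + 0\<^sub>m n 1 * 0\<^sub>m 1 n = A"
    using A by simp
  also have "A * ?y + 0\<^sub>m n 1 * mat 1 1 (\<lambda>_. - ?s) = ?w"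
    using A Ay by (intro eq_matI) (auto simp: scalar_prod_def atLeast0LessThan)
  also have "?v * 1\<^sub>m n + 1\<^sub>m 1 * 0\<^sub>m 1 n = ?v"
    by (subst right_mult_one_mat [of _ 1]) auto
  also have "?v * ?y + 1\<^sub>m 1 * mat 1 1 (\<lambda>_. - ?s) = 0\<^sub>m 1 1"
    using s by (intro eq_matI) (auto simp: scalar_prod_def atLeast0LessThan)
  finally have "det (four_block_mat A ?w ?v (0\<^sub>m 1 1)) =
      det (four_block_mat A (0\<^sub>m n 1) ?v (1\<^sub>m 1)) *
      det (four_block_mat (1\<^sub>m n) ?y (0\<^sub>m 1 n) (mat 1 1 (\<lambda>_. - ?s)))"
    using A by (subst det_mult [symmetric, where n = "n + 1"]) auto
  also have "\<dots> = (det A * det (1\<^sub>m 1)) * (det (1\<^sub>m n) * det (mat 1 1 (\<lambda>_. - ?s)))"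
    using A det_four_block_mat_upper_right_zero [OF A refl, of ?v 1 "1\<^sub>m 1"]
      det_four_block_mat_lower_left_zero [of "1\<^sub>m n" n ?y 1 _ "mat 1 1 (\<lambda>_. - ?s)"] by simp
  finally show ?thesis
    by (simp add: det_single)
qed

lemma sum_sum_rank_one:
  "(\<Sum>i<n. \<Sum>j<n. r i * sum_rank_one ps i j * s j)
     = (\<Sum>(k, a, b)\<leftarrow>ps. k * (\<Sum>i<n. r i * a i) * (\<Sum>j<n. b j * s j))"
proof (induction ps)
  case (Cons p ps)
  obtain k a b where p: "p = (k, a, b)"
    using prod_cases3 by blast
  have "(\<Sum>i<n. \<Sum>j<n. r i * sum_rank_one (p # ps) i j * s j)
      = k * (\<Sum>i<n. r i * a i) * (\<Sum>j<n. b j * s j) + (\<Sum>i<n. \<Sum>j<n. r i * sum_rank_one ps i j * s j)"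
    by (simp add: p sum_rank_one_def algebra_simps sum.distrib sum_distrib_left sum_distrib_right)
  with Cons show ?case
    by (simp add: p)
qed (simp add: sum_rank_one_def)

lemma sandwich_row: "sandwich n G v w = (\<Sum>i<n. (\<Sum>l<n. v l * G l i) * w i)"
  unfolding sandwich_def sum_distrib_right by (subst sum.swap) simp

lemma sandwich_col: "sandwich n G v w = (\<Sum>i<n. v i * (\<Sum>m<n. G i m * w m))"
  unfolding sandwich_def sum_distrib_left by (simp add: mult.assoc)

text \<open>
  If \<open>G\<close> and \<open>H\<close> invert \<open>A\<close> and \<open>C\<close>, then \<open>G (A f + d C) H = f H + G d\<close>.
\<close>
lemma sandwich_sylvester:
  fixes A C G H :: "nat \<Rightarrow> nat \<Rightarrow> 'a::comm_ring_1"
  assumes left: "\<And>i j. i < n \<Longrightarrow> j < n \<Longrightarrow> (\<Sum>k<n. G i k * A k j) = of_bool (i = j)"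
    and right: "\<And>i j. i < n \<Longrightarrow> j < n \<Longrightarrow> (\<Sum>k<n. C i k * H k j) = of_bool (i = j)"
    and P: "\<And>i j. i < n \<Longrightarrow> j < n \<Longrightarrow> A i j * f j + d i * C i j = sum_rank_one ps i j"
    and v': "\<And>j. j < n \<Longrightarrow> v' j = v j * f j"
    and w': "\<And>i. i < n \<Longrightarrow> w' i = d i * w i"
  shows "sandwich n H v' w + sandwich n G v w'
           = (\<Sum>(k, a, b)\<leftarrow>ps. k * sandwich n G v a * sandwich n H b w)"
proof -
  \<comment> \<open>The row \<open>r = v G\<close> satisfies \<open>v = r A\<close> and the column
    \<open>s = H w\<close> satisfies \<open>w = C s\<close>. Substituting these puts both terms
    between \<open>r\<close> and \<open>s\<close>, where \<open>P\<close> applies.\<close>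
  define r where "r = (\<lambda>i. \<Sum>l<n. v l * G l i)"
  define s where "s = (\<lambda>j. \<Sum>m<n. H j m * w m)"
  have r: "(\<Sum>i<n. r i * A i j) = v j" if "j < n" for j
    unfolding r_def using left that by (rule row_inverse_mult)
  have s: "(\<Sum>j<n. C i j * s j) = w i" if "i < n" for i
    unfolding s_def using right that by (rule mult_col_inverse)
  have "sandwich n H v' w = (\<Sum>j<n. v j * f j * s j)"
    unfolding sandwich_col s_def using v' by simp
  also have "\<dots> = (\<Sum>j<n. (\<Sum>i<n. r i * A i j) * f j * s j)"
    using r by simp
  also have "\<dots> = (\<Sum>i<n. \<Sum>j<n. r i * (A i j * f j) * s j)"
    unfolding sum_distrib_left sum_distrib_right by (subst sum.swap) (simp add: mult.assoc)
  finally have 1: "sandwich n H v' w = (\<Sum>i<n. \<Sum>j<n. r i * (A i j * f j) * s j)" .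
  have "sandwich n G v w' = (\<Sum>i<n. r i * (d i * w i))"
    unfolding sandwich_row r_def using w' by simp
  also have "\<dots> = (\<Sum>i<n. r i * (d i * (\<Sum>j<n. C i j * s j)))"
    using s by simp
  also have "\<dots> = (\<Sum>i<n. \<Sum>j<n. r i * (d i * C i j) * s j)"
    by (simp add: sum_distrib_left mult.assoc)
  finally have "sandwich n H v' w + sandwich n G v w'
      = (\<Sum>i<n. \<Sum>j<n. r i * (A i j * f j + d i * C i j) * s j)"
    by (simp add: 1 sum.distrib [symmetric] algebra_simps)
  also have "\<dots> = (\<Sum>i<n. \<Sum>j<n. r i * sum_rank_one ps i j * s j)"
    using P by simp
  also have "\<dots> = (\<Sum>(k, a, b)\<leftarrow>ps. k * sandwich n G v a * sandwich n H b w)"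
    unfolding sum_sum_rank_one sandwich_row [of n G] sandwich_col [of n H] r_def s_def ..
  finally show ?thesis .
qed

section \<open>Differentiation of determinants and inverses along a real parameter\<close>

lemma differentiable_det:
  fixes A :: "real \<Rightarrow> complex mat"
  assumes A: "\<And>s. A s \<in> carrier_mat n n"
    and diff: "\<And>i j. i < n \<Longrightarrow> j < n \<Longrightarrow> (\<lambda>s. A s $$ (i, j)) differentiable (at s0)"
  shows "(\<lambda>s. det (A s)) differentiable (at s0)"
proof -
  have "(\<lambda>s. \<Prod>i = 0..<n. A s $$ (i, p i)) differentiable (at s0)" if p: "p permutes {0..<n}" for p
  proof -
    have "\<forall>i\<in>{0..<n}. \<exists>D. ((\<lambda>s. A s $$ (i, p i)) has_derivative D) (at s0)"
      using diff permutes_in_image [OF p] by (fastforce simp: differentiable_def)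
    then obtain D where "\<And>i. i \<in> {0..<n} \<Longrightarrow> ((\<lambda>s. A s $$ (i, p i)) has_derivative D i) (at s0)"
      by metis
    then show ?thesis
      by (rule differentiableI [OF has_derivative_prod])
  qed
  then show ?thesis
    unfolding det_def'[OF A]
    by (intro differentiable_sum differentiable_mult ballI) (auto simp: finite_permutations)
qed

text \<open>Formulas that hold only where the determinant is nonzero thus hold on a neighbourhood
  and may be differentiated.\<close>

lemma eventually_det_nonzero:
  fixes A :: "real \<Rightarrow> complex mat"
  assumes A: "\<And>s. A s \<in> carrier_mat n n"
    and diff: "\<And>i j. i < n \<Longrightarrow> j < n \<Longrightarrow> (\<lambda>s. A s $$ (i, j)) differentiable (at s0)"
    and "det (A s0) \<noteq> 0"
  shows "\<forall>\<^sub>F s in nhds s0. det (A s) \<noteq> 0"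
proof -
  have "isCont (\<lambda>s. det (A s)) s0"
    using differentiable_det [OF A diff] differentiable_imp_continuous_within by blast
  then have "\<forall>\<^sub>F s in at s0. det (A s) \<noteq> 0"
    unfolding isCont_def using assms(3) by (rule tendsto_imp_eventually_ne)
  then show ?thesis
    unfolding eventually_nhds_conv_at using assms(3) by simp
qed

lemma differentiable_inv_entry:
  fixes A :: "real \<Rightarrow> complex mat"
  assumes A: "\<And>s. A s \<in> carrier_mat n n"
    and diff: "\<And>i j. i < n \<Longrightarrow> j < n \<Longrightarrow> (\<lambda>s. A s $$ (i, j)) differentiable (at s0)"
    and "det (A s0) \<noteq> 0" "i < n" "j < n"
  shows "(\<lambda>s. inv_entry (A s) i j) differentiable (at s0)"
proof -
  have dims: "dim_row (A s) = n" "dim_col (A s) = n" for s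
    using A by auto
  have "(\<lambda>s. det (mat_delete (A s) j i)) differentiable (at s0)"
  proof (rule differentiable_det)
    show "mat_delete (A s) j i \<in> carrier_mat (n - 1) (n - 1)" for s
      by (rule mat_delete_carrier [OF A])
    show "(\<lambda>s. mat_delete (A s) j i $$ (k, l)) differentiable (at s0)" if "k < n - 1" "l < n - 1" for k l
      using that diff by (simp add: mat_delete_def dims)
  qed
  then show ?thesis
    unfolding inv_entry_def cofactor_def
    by (intro differentiable_divide differentiable_mult differentiable_det [OF A diff]) (use assms in auto)
qed

text \<open>This is the rule \<open>G' = - G A' G\<close> between \<open>v\<close> and
  \<open>w\<close>. It follows by differentiating \<open>r A = v\<close> for the row
  \<open>r = v G\<close> and multiplying by the column \<open>y = G w\<close>.\<close>

lemma sandwich_has_vector_derivative: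
  fixes A G :: "real \<Rightarrow> nat \<Rightarrow> nat \<Rightarrow> complex"
  assumes left: "\<forall>\<^sub>F s in at s0. \<forall>i<n. \<forall>j<n. (\<Sum>k<n. G s i k * A s k j) = of_bool (i = j)"
    and left0: "\<And>i j. i < n \<Longrightarrow> j < n \<Longrightarrow> (\<Sum>k<n. G s0 i k * A s0 k j) = of_bool (i = j)"
    and right0: "\<And>i j. i < n \<Longrightarrow> j < n \<Longrightarrow> (\<Sum>k<n. A s0 i k * G s0 k j) = of_bool (i = j)"
    and G: "\<And>i j. i < n \<Longrightarrow> j < n \<Longrightarrow> (\<lambda>s. G s i j) differentiable (at s0)"
    and A: "\<And>i j. i < n \<Longrightarrow> j < n \<Longrightarrow> ((\<lambda>s. A s i j) has_vector_derivative sum_rank_one ps i j) (at s0)"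
    and v: "\<And>i. i < n \<Longrightarrow> ((\<lambda>s. v s i) has_vector_derivative \<kappa> * v' i) (at s0)"
    and w: "\<And>i. i < n \<Longrightarrow> ((\<lambda>s. w s i) has_vector_derivative \<mu> * w' i) (at s0)"
  shows "((\<lambda>s. sandwich n (G s) (v s) (w s)) has_vector_derivative
      \<kappa> * sandwich n (G s0) v' (w s0) + \<mu> * sandwich n (G s0) (v s0) w'
      - (\<Sum>(k, a, b)\<leftarrow>ps. k * sandwich n (G s0) (v s0) a * sandwich n (G s0) b (w s0))) (at s0)"
proof -
  define r where "r = (\<lambda>s i. \<Sum>l<n. v s l * G s l i)"
  define y where "y = (\<lambda>j. \<Sum>m<n. G s0 j m * w s0 m)"
  define r' where "r' = (\<lambda>i. vector_derivative (\<lambda>s. r s i) (at s0))"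
  have r': "((\<lambda>s. r s i) has_vector_derivative r' i) (at s0)" if "i < n" for i
    unfolding r'_def vector_derivative_works [symmetric] r_def using v G that
    by (intro differentiable_sum differentiable_mult ballI) (auto intro: differentiableI_vector)
  have y: "(\<Sum>j<n. A s0 i j * y j) = w s0 i" if "i < n" for i
    unfolding y_def using right0 that by (rule mult_col_inverse)
  \<comment> \<open>Near \<open>s0\<close> the functions \<open>r A\<close> and \<open>v\<close>
    agree, so the product rule and the given derivative of \<open>v\<close> yield the same
    value.\<close>
  have eq: "(\<Sum>i<n. r s0 i * sum_rank_one ps i j + r' i * A s0 i j) = \<kappa> * v' j" if "j < n" for j
  proof (rule vector_derivative_unique_at)
    show "((\<lambda>s. \<Sum>i<n. r s i * A s i j) has_vector_derivative
        (\<Sum>i<n. r s0 i * sum_rank_one ps i j + r' i * A s0 i j)) (at s0)"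
      using that r' A by (intro has_vector_derivative_sum has_vector_derivative_mult) auto
    have "\<forall>\<^sub>F s in at s0. v s j = (\<Sum>i<n. r s i * A s i j)"
      using left by eventually_elim (simp add: r_def row_inverse_mult that)
    moreover have "v s0 j = (\<Sum>i<n. r s0 i * A s0 i j)"
      using left0 that unfolding r_def by (subst row_inverse_mult) auto
    ultimately have ev: "\<forall>\<^sub>F s in nhds s0. v s j = (\<Sum>i<n. r s i * A s i j)"
      unfolding eventually_nhds_conv_at by simp
    show "((\<lambda>s. \<Sum>i<n. r s i * A s i j) has_vector_derivative \<kappa> * v' j) (at s0)"
      using v [OF that] eventually_nhds_x_imp_x [OF ev] eventually_mono [OF ev]
      by (subst (asm) has_vector_derivative_cong_ev) auto
  qed
  have col: "sandwich n (G s0) v' (w s0) = (\<Sum>j<n. v' j * y j)"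
    by (simp add: sandwich_col y_def)
  \<comment> \<open>Inserting \<open>w = A y\<close> produces \<open>r' A\<close>, which
    \<open>eq\<close> expresses without \<open>r'\<close>.\<close>
  have "(\<Sum>i<n. r' i * w s0 i) = (\<Sum>i<n. r' i * (\<Sum>j<n. A s0 i j * y j))"
    using y by simp
  also have "\<dots> = (\<Sum>j<n. (\<Sum>i<n. r' i * A s0 i j) * y j)"
    unfolding sum_distrib_left sum_distrib_right by (subst sum.swap) (simp add: mult.assoc)
  also have "\<dots> = (\<Sum>j<n. (\<kappa> * v' j - (\<Sum>i<n. r s0 i * sum_rank_one ps i j)) * y j)"
    using eq by (intro sum.cong arg_cong2 [where f = "(*)"] refl) (simp add: sum.distrib eq_diff_eq add.commute)
  also have "\<dots> = \<kappa> * sandwich n (G s0) v' (w s0) - (\<Sum>j<n. \<Sum>i<n. r s0 i * sum_rank_one ps i j * y j)"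
    unfolding col by (simp add: left_diff_distrib sum_subtractf sum_distrib_left sum_distrib_right mult.assoc)
  also have "(\<Sum>j<n. \<Sum>i<n. r s0 i * sum_rank_one ps i j * y j)
      = (\<Sum>(k, a, b)\<leftarrow>ps. k * sandwich n (G s0) (v s0) a * sandwich n (G s0) b (w s0))"
    by (subst sum.swap) (simp add: sum_sum_rank_one sandwich_row [of _ _ "v s0"]
        sandwich_col [of _ _ _ "w s0"] y_def r_def)
  finally have r'w: "(\<Sum>i<n. r' i * w s0 i) = \<kappa> * sandwich n (G s0) v' (w s0)
      - (\<Sum>(k, a, b)\<leftarrow>ps. k * sandwich n (G s0) (v s0) a * sandwich n (G s0) b (w s0))" .
  have "((\<lambda>s. \<Sum>i<n. r s i * w s i) has_vector_derivative
      (\<Sum>i<n. r s0 i * (\<mu> * w' i) + r' i * w s0 i)) (at s0)"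
    using r' w by (intro has_vector_derivative_sum has_vector_derivative_mult) auto
  moreover have "(\<Sum>i<n. r s0 i * (\<mu> * w' i)) = \<mu> * sandwich n (G s0) (v s0) w'"
    by (simp add: sandwich_row r_def sum_distrib_left mult.left_commute)
  ultimately show ?thesis
    unfolding sandwich_row [of n "G _" "v _" "w _"] r_def
    by (simp add: sum.distrib r'w [unfolded r_def] add.commute add_diff_eq)
qed

section \<open>Sylvester equations and their bilinear consequences at a fixed point\<close>

text \<open>A scalar equals its own transpose. Hence relations that mix \<open>M\<close> with its
  adjoint become relations between values of the form and their complex conjugates.\<close>

lemma sandwich_cnj: "sandwich n (\<lambda>i j. cnj (G j i)) v w = cnj (sandwich n G (\<lambda>i. cnj (w i)) (\<lambda>i. cnj (v i)))"
  unfolding sandwich_def cnj_sum by (subst sum.swap) (simp add: mult_ac)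

text \<open>
  The entries of \<open>M\<close>, using \<open>1 / z\<^sub>i\<^sup>* - 1 / z\<^sub>j = (\<lambda>\<^sub>i\<^sup>*)\<^sup>2 - \<lambda>\<^sub>j\<^sup>2\<close>.
\<close>
definition fl_kernel :: "real \<Rightarrow> (nat \<Rightarrow> complex) \<Rightarrow> (nat \<Rightarrow> complex) \<Rightarrow> (nat \<Rightarrow> complex) \<Rightarrow> (nat \<Rightarrow> complex)
    \<Rightarrow> nat \<Rightarrow> nat \<Rightarrow> complex" where
  "fl_kernel \<sigma> l e b1 b2 i j = 2 / ((cnj (l i))\<^sup>2 - (l j)\<^sup>2) *
     (l j * (cnj (e i) * e j) - cnj (l i) * (cnj (b1 i) * b1 j + \<sigma> * (cnj (b2 i) * b2 j)))"

text \<open>Here \<open>x\<close> and \<open>t\<close> are frozen and \<open>e\<close>,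
  \<open>b1\<close>, \<open>b2\<close> are arbitrary vectors; the identities below do not use their
  exponential form.\<close>

locale fl_algebra =
  fixes N :: nat and \<sigma> :: real and l e b1 b2 :: "nat \<Rightarrow> complex" and G :: "nat \<Rightarrow> nat \<Rightarrow> complex"
  assumes l_nonzero: "\<And>i. i < N \<Longrightarrow> l i \<noteq> 0"
    and nonres: "\<And>i j. i < N \<Longrightarrow> j < N \<Longrightarrow> (cnj (l i))\<^sup>2 \<noteq> (l j)\<^sup>2"
    and left_inverse: "\<And>i j. i < N \<Longrightarrow> j < N \<Longrightarrow> (\<Sum>k<N. G i k * fl_kernel \<sigma> l e b1 b2 k j) = of_bool (i = j)"
    and right_inverse: "\<And>i j. i < N \<Longrightarrow> j < N \<Longrightarrow> (\<Sum>k<N. fl_kernel \<sigma> l e b1 b2 i k * G k j) = of_bool (i = j)"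
begin

abbreviation "F \<equiv> sandwich N G"
abbreviation "A \<equiv> fl_kernel \<sigma> l e b1 b2"
abbreviation "E \<equiv> \<lambda>i. cnj (e i)"
abbreviation "B1 \<equiv> \<lambda>i. cnj (b1 i)"
abbreviation "B2 \<equiv> \<lambda>i. cnj (b2 i)"

abbreviation "p \<equiv> 1 + 2 * F (\<lambda>i. e i / l i) E"
abbreviation "q \<equiv> F (\<lambda>i. l i * e i) (\<lambda>i. E i / (cnj (l i))\<^sup>2)"

text \<open>The weight \<open>(l j)\<^sup>2 - (cnj (l i))\<^sup>2\<close> cancels the denominator of
  the kernel and leaves rank one terms. Since \<open>v'\<close> and \<open>w'\<close> are
  constrained only entrywise below \<open>N\<close>, the lemma also applies when \<open>w\<close>
  itself is a quotient by \<open>(cnj (l i))\<^sup>2\<close>.\<close>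

lemma sylvester_sq:
  assumes "\<And>i. i < N \<Longrightarrow> v' i = v i * (l i)\<^sup>2" and "\<And>i. i < N \<Longrightarrow> w' i = (cnj (l i))\<^sup>2 * w i"
  shows "F v w' - F v' w = 2 * F v E * F (\<lambda>i. l i * e i) w
    - 2 * (F v (\<lambda>i. cnj (l i) * B1 i) * F b1 w + \<sigma> * F v (\<lambda>i. cnj (l i) * B2 i) * F b2 w)"
proof -
  have "A i j * (l j)\<^sup>2 + (- (cnj (l i))\<^sup>2) * A i j = sum_rank_one
     [(- 2, E, \<lambda>j. l j * e j), (2, \<lambda>i. cnj (l i) * B1 i, b1), (2 * \<sigma>, \<lambda>i. cnj (l i) * B2 i, b2)] i j"
    if "i < N" "j < N" for i j
  proof -
    have "2 / (L\<^sup>2 - m\<^sup>2) * X * m\<^sup>2 + (- L\<^sup>2) * (2 / (L\<^sup>2 - m\<^sup>2) * X) = - 2 * X"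
      if "L\<^sup>2 \<noteq> m\<^sup>2" for L m X :: complex
      using that by (simp add: divide_simps) (simp add: algebra_simps)
    note eq = this [OF nonres [OF that]]
    show ?thesis
      unfolding fl_kernel_def by (subst eq) (simp add: sum_rank_one_def algebra_simps)
  qed
  from sandwich_sylvester [OF left_inverse right_inverse this, of v' v "\<lambda>i. - w' i" w] assms
  have "F v' w + F v (\<lambda>i. - w' i) = - 2 * F v E * F (\<lambda>i. l i * e i) w
    + (2 * F v (\<lambda>i. cnj (l i) * B1 i) * F b1 w + 2 * \<sigma> * F v (\<lambda>i. cnj (l i) * B2 i) * F b2 w)"
    by simp
  moreover have "F v (\<lambda>i. - w' i) = - F v w'"
    by (simp add: sandwich_def sum_negf)
  ultimately show ?thesis
    by (simp add: algebra_simps)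
qed

text \<open>With \<open>L = cnj (l i)\<close> and \<open>m = l j\<close>, the weight
  \<open>1 / m\<^sup>2 - 1 / L\<^sup>2\<close> is the denominator
  \<open>L\<^sup>2 - m\<^sup>2\<close> divided by \<open>L\<^sup>2 * m\<^sup>2\<close>. The
  remaining powers are shared between the column and the row of each rank one term.\<close>

lemma sylvester_inv_sq:
  assumes "\<And>i. i < N \<Longrightarrow> v' i = v i / (l i)\<^sup>2" and "\<And>i. i < N \<Longrightarrow> w' i = w i / (cnj (l i))\<^sup>2"
  shows "F v' w - F v w' = 2 * F v (\<lambda>i. E i / (cnj (l i))\<^sup>2) * F (\<lambda>i. e i / l i) w
    - 2 * (F v (\<lambda>i. B1 i / cnj (l i)) * F (\<lambda>i. b1 i / (l i)\<^sup>2) w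
       + \<sigma> * F v (\<lambda>i. B2 i / cnj (l i)) * F (\<lambda>i. b2 i / (l i)\<^sup>2) w)"
proof -
  have "A i j * (1 / (l j)\<^sup>2) + (- 1 / (cnj (l i))\<^sup>2) * A i j = sum_rank_one
     [(2, \<lambda>i. E i / (cnj (l i))\<^sup>2, \<lambda>j. e j / l j), (- 2, \<lambda>i. B1 i / cnj (l i), \<lambda>j. b1 j / (l j)\<^sup>2),
      (- 2 * \<sigma>, \<lambda>i. B2 i / cnj (l i), \<lambda>j. b2 j / (l j)\<^sup>2)] i j"
    if "i < N" "j < N" for i j
  proof -
    have "2 / (L\<^sup>2 - m\<^sup>2) * X * (1 / m\<^sup>2) + (- 1 / L\<^sup>2) * (2 / (L\<^sup>2 - m\<^sup>2) * X) = 2 * X / (L\<^sup>2 * m\<^sup>2)"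
      if "L\<^sup>2 \<noteq> m\<^sup>2" "L \<noteq> 0" "m \<noteq> 0" for L m X :: complex
      using that by (simp add: divide_simps) (simp add: algebra_simps)
    note eq = this [OF nonres [OF that]]
    from l_nonzero that show ?thesis
      unfolding fl_kernel_def by (subst eq) (simp_all add: sum_rank_one_def field_simps power2_eq_square)
  qed
  from sandwich_sylvester [OF left_inverse right_inverse this, of v' v "\<lambda>i. - w' i" w] assms
  have "F v' w + F v (\<lambda>i. - w' i) = 2 * F v (\<lambda>i. E i / (cnj (l i))\<^sup>2) * F (\<lambda>i. e i / l i) w
    + (- (2 * F v (\<lambda>i. B1 i / cnj (l i)) * F (\<lambda>i. b1 i / (l i)\<^sup>2) w)
       - 2 * \<sigma> * F v (\<lambda>i. B2 i / cnj (l i)) * F (\<lambda>i. b2 i / (l i)\<^sup>2) w)"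
    by simp
  moreover have "F v (\<lambda>i. - w' i) = - F v w'"
    by (simp add: sandwich_def sum_negf)
  ultimately show ?thesis
    by (simp add: algebra_simps)
qed

abbreviation "A' \<equiv> \<lambda>i j. cnj (A j i)"
abbreviation "F' \<equiv> sandwich N (\<lambda>i j. cnj (G j i))"

text \<open>Swapping indices and conjugating reverses the sign of the denominator and exchanges the
  weights \<open>l j\<close> and \<open>cnj (l i)\<close>. In this form \<open>A\<close> and
  \<open>A'\<close> share a denominator.\<close>

lemma adjoint_kernel:
  "A' i j = - (2 / ((cnj (l i))\<^sup>2 - (l j)\<^sup>2) *
     (cnj (l i) * (E i * e j) - l j * (B1 i * b1 j + \<sigma> * (B2 i * b2 j))))"
proof -
  have "2 / (m\<^sup>2 - L\<^sup>2) * X = - (2 / (L\<^sup>2 - m\<^sup>2) * X)" for L m X :: complex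
    by (metis minus_diff_eq minus_divide_right mult_minus_left)
  moreover have "A' i j = 2 / ((l j)\<^sup>2 - (cnj (l i))\<^sup>2) *
     (cnj (l i) * (E i * e j) - l j * (B1 i * b1 j + \<sigma> * (B2 i * b2 j)))"
    by (simp add: fl_kernel_def mult.commute)
  ultimately show ?thesis
    by (rule back_subst [rotated])
qed

lemma adjoint_left_inverse: "i < N \<Longrightarrow> j < N \<Longrightarrow> (\<Sum>k<N. cnj (G k i) * A' k j) = of_bool (i = j)"
  using arg_cong [OF right_inverse [of j i], of cnj] by (simp add: mult.commute eq_commute [of j])

lemma adjoint_right_inverse: "i < N \<Longrightarrow> j < N \<Longrightarrow> (\<Sum>k<N. A' i k * cnj (G j k)) = of_bool (i = j)"
  using arg_cong [OF left_inverse [of j i], of cnj] by (simp add: mult.commute eq_commute [of j])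

text \<open>In \<open>A i j * l j + cnj (l i) * A' i j\<close> the contributions of
  \<open>b1\<close> and \<open>b2\<close> carry the factor \<open>cnj (l i) * l j\<close> with
  opposite signs and cancel, so only the \<open>e\<close> term survives.\<close>

lemma sylvester_adjoint_right:
  assumes "\<And>i. i < N \<Longrightarrow> v' i = v i * l i" and "\<And>i. i < N \<Longrightarrow> w' i = cnj (l i) * w i"
  shows "F' v' w + F v w' = - 2 * F v E * F' e w"
proof -
  have "A i j * l j + cnj (l i) * A' i j = sum_rank_one [(- 2, E, e)] i j"
    if "i < N" "j < N" for i j
  proof -
    have "2 / (L\<^sup>2 - m\<^sup>2) * (m * X - L * Y) * m + L * - (2 / (L\<^sup>2 - m\<^sup>2) * (L * X - m * Y)) = - 2 * X"
      if "L\<^sup>2 \<noteq> m\<^sup>2" for L m X Y :: complex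
      using that by (simp add: divide_simps) (simp add: algebra_simps power2_eq_square)
    note eq = this [OF nonres [OF that]]
    show ?thesis
      unfolding adjoint_kernel unfolding fl_kernel_def by (subst eq) (simp add: sum_rank_one_def algebra_simps)
  qed
  from sandwich_sylvester [OF left_inverse adjoint_right_inverse this, of v' v w' w] assms
  show ?thesis by simp
qed

text \<open>With the roles of \<open>A\<close> and \<open>A'\<close> exchanged it is the
  \<open>e\<close> term that cancels, and those of \<open>b1\<close> and \<open>b2\<close>
  survive.\<close>

lemma sylvester_adjoint_left:
  assumes "\<And>i. i < N \<Longrightarrow> v' i = v i * l i" and "\<And>i. i < N \<Longrightarrow> w' i = cnj (l i) * w i"
  shows "F v' w + F' v w' = - 2 * (F' v B1 * F b1 w + \<sigma> * F' v B2 * F b2 w)"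
proof -
  have "A' i j * l j + cnj (l i) * A i j = sum_rank_one [(- 2, B1, b1), (- 2 * \<sigma>, B2, b2)] i j"
    if "i < N" "j < N" for i j
  proof -
    have "- (2 / (L\<^sup>2 - m\<^sup>2) * (L * X - m * Y)) * m + L * (2 / (L\<^sup>2 - m\<^sup>2) * (m * X - L * Y)) = - 2 * Y"
      if "L\<^sup>2 \<noteq> m\<^sup>2" for L m X Y :: complex
      using that by (simp add: divide_simps) (simp add: algebra_simps power2_eq_square)
    note eq = this [OF nonres [OF that]]
    show ?thesis
      unfolding adjoint_kernel unfolding fl_kernel_def by (subst eq) (simp add: sum_rank_one_def algebra_simps)
  qed
  from sandwich_sylvester [OF adjoint_left_inverse right_inverse this, of v' v w' w] assms
  show ?thesis by simp
qed

text \<open>For \<open>f = F (\<lambda>i. e i / l i) E\<close> the adjoint relation reads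
  \<open>f + cnj f = - 2 * f * cnj f\<close>, which is \<open>1 + 2 * f\<close> having modulus
  one.\<close>

lemma p_unimodular: "p * cnj p = 1"
proof -
  have "F' e (\<lambda>i. E i / cnj (l i)) + F (\<lambda>i. e i / l i) E
      = - 2 * F (\<lambda>i. e i / l i) E * F' e (\<lambda>i. E i / cnj (l i))"
    by (rule sylvester_adjoint_right) (auto simp: l_nonzero)
  then have "cnj (F (\<lambda>i. e i / l i) E) + F (\<lambda>i. e i / l i) E
      = - 2 * F (\<lambda>i. e i / l i) E * cnj (F (\<lambda>i. e i / l i) E)"
    by (simp add: sandwich_cnj)
  moreover have "(1 + 2 * f) * cnj (1 + 2 * f) = 1" if "cnj f + f = - 2 * f * cnj f" for f
  proof -
    have "(1 + 2 * f) * cnj (1 + 2 * f) = 1 + 2 * (cnj f + f) + 4 * f * cnj f"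
      by (simp add: algebra_simps)
    then show ?thesis
      unfolding that by simp
  qed
  ultimately show ?thesis
    by blast
qed

text \<open>Used for the \<open>t\<close>-derivative of \<open>p\<close>, where it brings in the
  conjugates of the solution components.\<close>

lemma e_b_identity:
  "F (\<lambda>i. e i / l i) (\<lambda>i. cnj (l i) * cnj (b i)) = - p * cnj (F b E)"
proof -
  have "F' e (\<lambda>i. cnj (b i)) + F (\<lambda>i. e i / l i) (\<lambda>i. cnj (l i) * cnj (b i))
      = - 2 * F (\<lambda>i. e i / l i) E * F' e (\<lambda>i. cnj (b i))"
    by (rule sylvester_adjoint_right) (auto simp: l_nonzero)
  then show ?thesis
    by (simp add: sandwich_cnj algebra_simps eq_neg_iff_add_eq_0)
qed

text \<open>The left adjoint relation gives \<open>q + cnj f\<close>, with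
  \<open>p = 1 + 2 * f\<close>. Multiplying by \<open>2 * p\<close> and using
  \<open>p * cnj p = 1\<close> removes \<open>cnj f\<close>. The left-hand side is the common factor
  of both Fokas-Lenells equations.\<close>

lemma u_w_identity:
  "(2 * q - 1) * p + 1
    + 4 * p * (cnj (F b1 E) * F b1 (\<lambda>i. E i / (cnj (l i))\<^sup>2) + \<sigma> * (cnj (F b2 E) * F b2 (\<lambda>i. E i / (cnj (l i))\<^sup>2))) = 0"
proof -
  have "F (\<lambda>i. l i * e i) (\<lambda>i. E i / (cnj (l i))\<^sup>2) + F' e (\<lambda>i. E i / cnj (l i))
      = - 2 * (F' e B1 * F b1 (\<lambda>i. E i / (cnj (l i))\<^sup>2) + \<sigma> * F' e B2 * F b2 (\<lambda>i. E i / (cnj (l i))\<^sup>2))"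
    by (rule sylvester_adjoint_left) (auto simp: l_nonzero power2_eq_square)
  then have *: "q + cnj (F (\<lambda>i. e i / l i) E) = - 2 * (cnj (F b1 E) * F b1 (\<lambda>i. E i / (cnj (l i))\<^sup>2)
      + \<sigma> * (cnj (F b2 E) * F b2 (\<lambda>i. E i / (cnj (l i))\<^sup>2)))"
    by (simp add: sandwich_cnj)
  have "(2 * y - 1) * (1 + 2 * f) + 1 + 4 * (1 + 2 * f) * T = 0"
    if "y + cnj f = - 2 * T" "(1 + 2 * f) * cnj (1 + 2 * f) = 1" for y f T :: complex
  proof -
    have "(2 * y - 1) * (1 + 2 * f) + 1 + 4 * (1 + 2 * f) * T
        = (2 * y - 1) * (1 + 2 * f) + 1 - 2 * (1 + 2 * f) * (- 2 * T)"
      by simp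
    also have "\<dots> = 1 - (1 + 2 * f) * cnj (1 + 2 * f)"
      unfolding that(1) [symmetric] by (simp add: algebra_simps)
    finally show ?thesis
      unfolding that(2) by simp
  qed
  from this [OF * p_unimodular] show ?thesis .
qed

end

section \<open>Derivatives of the forms and of the kernel\<close>

lemma sandwich_inv_entry_has_vector_derivative:
  fixes A :: "real \<Rightarrow> complex mat"
  assumes carrier: "\<And>s. A s \<in> carrier_mat n n"
    and det: "det (A s0) \<noteq> 0"
    and A: "\<And>i j. i < n \<Longrightarrow> j < n \<Longrightarrow> ((\<lambda>s. A s $$ (i, j)) has_vector_derivative sum_rank_one ps i j) (at s0)"
    and v: "\<And>i. i < n \<Longrightarrow> ((\<lambda>s. v s i) has_vector_derivative \<kappa> * v' i) (at s0)"
    and w: "\<And>i. i < n \<Longrightarrow> ((\<lambda>s. w s i) has_vector_derivative \<mu> * w' i) (at s0)"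
  defines "F \<equiv> sandwich n (inv_entry (A s0))"
  shows "((\<lambda>s. sandwich n (inv_entry (A s)) (v s) (w s)) has_vector_derivative
      \<kappa> * F v' (w s0) + \<mu> * F (v s0) w' - (\<Sum>(k, a, b)\<leftarrow>ps. k * F (v s0) a * F b (w s0))) (at s0)"
  unfolding F_def
proof (rule sandwich_has_vector_derivative [where A = "\<lambda>s i j. A s $$ (i, j)"])
  have diff: "(\<lambda>s. A s $$ (i, j)) differentiable at s0" if "i < n" "j < n" for i j
    using A [OF that] by (rule differentiableI_vector)
  show "(\<lambda>s. inv_entry (A s) i j) differentiable at s0" if "i < n" "j < n" for i j
    using carrier diff det that by (rule differentiable_inv_entry)
  have "\<forall>\<^sub>F s in at s0. det (A s) \<noteq> 0"
    using eventually_det_nonzero [OF carrier diff det] by (simp add: eventually_nhds_conv_at)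
  then show "\<forall>\<^sub>F s in at s0. \<forall>i<n. \<forall>j<n. (\<Sum>k<n. inv_entry (A s) i k * A s $$ (k, j)) = of_bool (i = j)"
    by eventually_elim (simp add: inv_entry_mult_left [OF carrier])
qed (use assms inv_entry_mult_left [OF carrier det] inv_entry_mult_right [OF carrier det] in auto)

text \<open>The products of \<open>e\<close> entries evolve with rate
  \<open>cnj (r i) + r j\<close>, those of \<open>b1\<close> and \<open>b2\<close> with the opposite
  rate. By hypothesis this rate is \<open>\<rho>\<close> times the denominator, which therefore
  cancels, and the minus sign in the kernel turns into a plus. The factor \<open>\<rho>\<close> may
  depend on \<open>i\<close> and \<open>j\<close>.\<close>

lemma fl_kernel_has_vector_derivative:
  fixes e b1 b2 :: "real \<Rightarrow> nat \<Rightarrow> complex"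
  assumes e: "\<And>k. k \<in> {i, j} \<Longrightarrow> ((\<lambda>s. e s k) has_vector_derivative r k * e s0 k) (at s0)"
    and b1: "\<And>k. k \<in> {i, j} \<Longrightarrow> ((\<lambda>s. b1 s k) has_vector_derivative - r k * b1 s0 k) (at s0)"
    and b2: "\<And>k. k \<in> {i, j} \<Longrightarrow> ((\<lambda>s. b2 s k) has_vector_derivative - r k * b2 s0 k) (at s0)"
    and r: "cnj (r i) + r j = \<rho> * ((cnj (l i))\<^sup>2 - (l j)\<^sup>2)"
    and nonres: "(cnj (l i))\<^sup>2 \<noteq> (l j)\<^sup>2"
  shows "((\<lambda>s. fl_kernel \<sigma> l (e s) (b1 s) (b2 s) i j) has_vector_derivative
      2 * \<rho> * (l j * (cnj (e s0 i) * e s0 j)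
        + cnj (l i) * (cnj (b1 s0 i) * b1 s0 j + \<sigma> * (cnj (b2 s0 i) * b2 s0 j)))) (at s0)"
proof -
  have prod: "((\<lambda>s. cnj (f s i) * f s j) has_vector_derivative
      (cnj (k i) + k j) * (cnj (f s0 i) * f s0 j)) (at s0)"
    if "\<And>m. m \<in> {i, j} \<Longrightarrow> ((\<lambda>s. f s m) has_vector_derivative k m * f s0 m) (at s0)"
    for f :: "real \<Rightarrow> nat \<Rightarrow> complex" and k
  proof -
    have "((\<lambda>s. cnj (f s i) * f s j) has_vector_derivative
        cnj (f s0 i) * (k j * f s0 j) + cnj (k i * f s0 i) * f s0 j) (at s0)"
      using that by (intro has_vector_derivative_mult has_vector_derivative_cnj) auto
    then show ?thesis
      by (simp add: algebra_simps)
  qed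
  let ?D = "(cnj (l i))\<^sup>2 - (l j)\<^sup>2" and ?X = "cnj (e s0 i) * e s0 j"
    and ?Y1 = "cnj (b1 s0 i) * b1 s0 j" and ?Y2 = "cnj (b2 s0 i) * b2 s0 j"
  have "((\<lambda>s. fl_kernel \<sigma> l (e s) (b1 s) (b2 s) i j) has_vector_derivative
      2 / ?D * (l j * ((cnj (r i) + r j) * ?X)
        - cnj (l i) * ((cnj (- r i) + - r j) * ?Y1 + \<sigma> * ((cnj (- r i) + - r j) * ?Y2)))) (at s0)"
    unfolding fl_kernel_def
    by (intro has_vector_derivative_mult_right has_vector_derivative_diff has_vector_derivative_add
        prod [OF e] prod [OF b1, of "\<lambda>k. k"] prod [OF b2, of "\<lambda>k. k"])
  moreover have alg: "d * (l j * ((cnj (r i) + r j) * X) - cnj (l i) * ((cnj (- r i) + - r j) * Y1 + \<sigma> * ((cnj (- r i) + - r j) * Y2)))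
      = d * (cnj (r i) + r j) * (l j * X + cnj (l i) * (Y1 + \<sigma> * Y2))" for d X Y1 Y2 :: complex
    by (simp add: algebra_simps)
  moreover have \<rho>: "2 / ?D * (cnj (r i) + r j) = 2 * \<rho>"
    unfolding r using nonres by simp
  ultimately show ?thesis
    by (simp only: alg \<rho>)
qed

section \<open>The soliton data as functions of \<open>x\<close> and \<open>t\<close>\<close>

locale fl_soliton =
  fixes N :: nat and \<sigma> :: real and lam :: "nat \<Rightarrow> complex" and c :: "nat \<Rightarrow> nat \<Rightarrow> complex"
  assumes Im_zpar: "\<And>i. i < N \<Longrightarrow> Im (zpar lam i) < 0"
begin

definition "e x t i = exp (theta lam i x t)"
definition "b s x t i = c i s * exp (- theta lam i x t)"
definition "G x t = inv_entry (Mmat N \<sigma> lam c x t)"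

lemma lam_nonzero: "i < N \<Longrightarrow> lam i \<noteq> 0"
  \<comment> \<open>If \<open>lam i\<close> were 0, division by zero would give
    \<open>zpar lam i = 0\<close>, whose imaginary part is not negative.\<close>
  using Im_zpar [of i] by (auto simp: zpar_def)

text \<open>The two numbers lie in opposite open half planes. This keeps the denominators of
  \<open>M\<close> away from zero.\<close>

lemma zpar_cnj_neq: "i < N \<Longrightarrow> j < N \<Longrightarrow> zpar lam j \<noteq> cnj (zpar lam i)"
  using Im_zpar [of i] Im_zpar [of j] by (auto simp: complex_eq_iff)

lemma nonresonant: "i < N \<Longrightarrow> j < N \<Longrightarrow> (cnj (lam i))\<^sup>2 \<noteq> (lam j)\<^sup>2"
  using zpar_cnj_neq [of i j] by (auto simp: zpar_def)

lemma Mmat_entry: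
  assumes "i < N" "j < N"
  shows "Mmat N \<sigma> lam c x t $$ (i, j) = fl_kernel \<sigma> lam (e x t) (b 1 x t) (b 2 x t) i j"
proof -
  have K: "2 * cnj (zpar lam i) * zpar lam j / (zpar lam j - cnj (zpar lam i))
      = 2 / ((cnj (lam i))\<^sup>2 - (lam j)\<^sup>2)"
    using lam_nonzero [of i] lam_nonzero [of j] nonresonant [of i j] assms
    by (simp add: zpar_def divide_simps)
  have X: "lam j * exp (cnj (theta lam i x t) + theta lam j x t)
        + cnj (lam i) * gam \<sigma> c i j * exp (- cnj (theta lam i x t) - theta lam j x t)
      = lam j * (cnj (e x t i) * e x t j) - cnj (lam i) *
        (cnj (b 1 x t i) * b 1 x t j + \<sigma> * (cnj (b 2 x t i) * b 2 x t j))"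
    by (simp add: e_def b_def gam_def exp_cnj exp_add exp_diff exp_minus algebra_simps divide_inverse)
  show ?thesis
    unfolding fl_kernel_def using assms by (simp only: Mmat_def index_mat prod.case K X)
qed

lemma Mmat_carrier: "Mmat N \<sigma> lam c x t \<in> carrier_mat N N"
  by (simp add: Mmat_def)

lemma fl_algebra_at:
  assumes "det (Mmat N \<sigma> lam c x t) \<noteq> 0"
  shows "fl_algebra N \<sigma> lam (e x t) (b 1 x t) (b 2 x t) (G x t)"
proof
  show "(\<Sum>k<N. G x t i k * fl_kernel \<sigma> lam (e x t) (b 1 x t) (b 2 x t) k j) = of_bool (i = j)"
    "(\<Sum>k<N. fl_kernel \<sigma> lam (e x t) (b 1 x t) (b 2 x t) i k * G x t k j) = of_bool (i = j)"
    if "i < N" "j < N" for i j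
    using inv_entry_mult_left [OF Mmat_carrier assms that] inv_entry_mult_right [OF Mmat_carrier assms that]
    by (simp_all add: Mmat_entry that G_def)
qed (use lam_nonzero nonresonant in auto)

lemma bright_soliton_eq:
  assumes "det (Mmat N \<sigma> lam c x t) \<noteq> 0"
  shows "bright_soliton N \<sigma> lam c s x t = 2 * sandwich N (G x t) (b s x t) (\<lambda>i. cnj (e x t i))"
proof -
  have "conj_transpose (Y1 N lam x t) = mat N 1 (\<lambda>(i, _). cnj (e x t i))"
    by (intro eq_matI) (auto simp: conj_transpose_def Y1_def e_def)
  moreover have "Y2 N lam c s x t = mat 1 N (\<lambda>(_, j). b s x t j)"
    by (simp add: Y2_def b_def)
  ultimately show ?thesis
    using assms det_bordered [OF Mmat_carrier assms, of "\<lambda>i. cnj (e x t i)" "b s x t"]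
    by (simp add: bright_soliton_def G_def)
qed

lemma theta_x: "((\<lambda>\<xi>. theta lam i \<xi> t) has_vector_derivative \<i> / (lam i)\<^sup>2) (at x)"
  unfolding theta_def zpar_def by (auto intro!: derivative_eq_intros)

lemma theta_t: "((\<lambda>\<tau>. theta lam i x \<tau>) has_vector_derivative \<i> * (lam i)\<^sup>2 / 4) (at t)"
  unfolding theta_def zpar_def by (auto intro!: derivative_eq_intros)

lemma exp_has_vector_derivative:
  fixes f :: "real \<Rightarrow> complex"
  assumes "(f has_vector_derivative k) (at s)"
  shows "((\<lambda>s. exp (f s)) has_vector_derivative k * exp (f s)) (at s)"
  using field_vector_diff_chain_at [OF assms DERIV_exp] by (simp add: o_def)

lemma e_x: "((\<lambda>\<xi>. e \<xi> t i) has_vector_derivative \<i> / (lam i)\<^sup>2 * e x t i) (at x)"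
  unfolding e_def by (intro exp_has_vector_derivative theta_x)

lemma e_t: "((\<lambda>\<tau>. e x \<tau> i) has_vector_derivative \<i> * (lam i)\<^sup>2 / 4 * e x t i) (at t)"
  unfolding e_def by (intro exp_has_vector_derivative theta_t)

lemma b_x: "((\<lambda>\<xi>. b s \<xi> t i) has_vector_derivative - (\<i> / (lam i)\<^sup>2) * b s x t i) (at x)"
  using has_vector_derivative_mult_right [OF exp_has_vector_derivative [OF has_vector_derivative_minus [OF theta_x]], of "c i s"]
  unfolding b_def by (simp add: mult.left_commute)

lemma b_t: "((\<lambda>\<tau>. b s x \<tau> i) has_vector_derivative - (\<i> * (lam i)\<^sup>2 / 4) * b s x t i) (at t)"
  using has_vector_derivative_mult_right [OF exp_has_vector_derivative [OF has_vector_derivative_minus [OF theta_t]], of "c i s"]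
  unfolding b_def by (simp add: mult.left_commute)

lemma Mmat_x:
  assumes "i < N" "j < N"
  shows "((\<lambda>\<xi>. Mmat N \<sigma> lam c \<xi> t $$ (i, j)) has_vector_derivative sum_rank_one
    [(2 * \<i>, \<lambda>i. cnj (e x t i) / (cnj (lam i))\<^sup>2, \<lambda>i. e x t i / lam i),
     (2 * \<i>, \<lambda>i. cnj (b 1 x t i) / cnj (lam i), \<lambda>i. b 1 x t i / (lam i)\<^sup>2),
     (2 * \<i> * \<sigma>, \<lambda>i. cnj (b 2 x t i) / cnj (lam i), \<lambda>i. b 2 x t i / (lam i)\<^sup>2)] i j) (at x)"
proof -
  \<comment> \<open>The rates are \<open>\<i> / (lam i)\<^sup>2\<close>, so \<open>\<rho>\<close> is
    \<open>\<i> / ((cnj (lam i))\<^sup>2 * (lam j)\<^sup>2)\<close>; it factors over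
    \<open>i\<close> and \<open>j\<close>, which keeps every term of rank one.\<close>
  have "((\<lambda>\<xi>. Mmat N \<sigma> lam c \<xi> t $$ (i, j)) has_vector_derivative
     2 * (\<i> / ((cnj (lam i))\<^sup>2 * (lam j)\<^sup>2)) * (lam j * (cnj (e x t i) * e x t j)
        + cnj (lam i) * (cnj (b 1 x t i) * b 1 x t j + \<sigma> * (cnj (b 2 x t i) * b 2 x t j)))) (at x)"
    unfolding Mmat_entry [OF assms] using lam_nonzero assms
    by (intro fl_kernel_has_vector_derivative [where r = "\<lambda>i. \<i> / (lam i)\<^sup>2"] e_x b_x nonresonant)
      (auto simp: field_simps)
  moreover have "2 * (\<i> / ((cnj (lam i))\<^sup>2 * (lam j)\<^sup>2)) * (lam j * (cnj (e x t i) * e x t j)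
        + cnj (lam i) * (cnj (b 1 x t i) * b 1 x t j + \<sigma> * (cnj (b 2 x t i) * b 2 x t j))) = sum_rank_one
    [(2 * \<i>, \<lambda>i. cnj (e x t i) / (cnj (lam i))\<^sup>2, \<lambda>i. e x t i / lam i),
     (2 * \<i>, \<lambda>i. cnj (b 1 x t i) / cnj (lam i), \<lambda>i. b 1 x t i / (lam i)\<^sup>2),
     (2 * \<i> * \<sigma>, \<lambda>i. cnj (b 2 x t i) / cnj (lam i), \<lambda>i. b 2 x t i / (lam i)\<^sup>2)] i j"
    using lam_nonzero assms by (simp add: sum_rank_one_def field_simps power2_eq_square)
  ultimately show ?thesis
    by (simp only:)
qed

lemma Mmat_t:
  assumes "i < N" "j < N"
  shows "((\<lambda>\<tau>. Mmat N \<sigma> lam c x \<tau> $$ (i, j)) has_vector_derivative sum_rank_one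
    [(- \<i> / 2, \<lambda>i. cnj (e x t i), \<lambda>i. lam i * e x t i),
     (- \<i> / 2, \<lambda>i. cnj (lam i) * cnj (b 1 x t i), b 1 x t),
     (- \<i> / 2 * \<sigma>, \<lambda>i. cnj (lam i) * cnj (b 2 x t i), b 2 x t)] i j) (at t)"
proof -
  \<comment> \<open>The rates are \<open>\<i> * (lam i)\<^sup>2 / 4\<close>, so
    \<open>\<rho>\<close> is the constant \<open>- \<i> / 4\<close>.\<close>
  have "((\<lambda>\<tau>. Mmat N \<sigma> lam c x \<tau> $$ (i, j)) has_vector_derivative
     2 * (- \<i> / 4) * (lam j * (cnj (e x t i) * e x t j)
        + cnj (lam i) * (cnj (b 1 x t i) * b 1 x t j + \<sigma> * (cnj (b 2 x t i) * b 2 x t j)))) (at t)"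
    unfolding Mmat_entry [OF assms] using assms
    by (intro fl_kernel_has_vector_derivative [where r = "\<lambda>i. \<i> * (lam i)\<^sup>2 / 4"] e_t b_t nonresonant)
      (auto simp: field_simps)
  moreover have "2 * (- \<i> / 4) * (lam j * (cnj (e x t i) * e x t j)
        + cnj (lam i) * (cnj (b 1 x t i) * b 1 x t j + \<sigma> * (cnj (b 2 x t i) * b 2 x t j))) = sum_rank_one
    [(- \<i> / 2, \<lambda>i. cnj (e x t i), \<lambda>i. lam i * e x t i),
     (- \<i> / 2, \<lambda>i. cnj (lam i) * cnj (b 1 x t i), b 1 x t),
     (- \<i> / 2 * \<sigma>, \<lambda>i. cnj (lam i) * cnj (b 2 x t i), b 2 x t)] i j"
    by (simp add: sum_rank_one_def field_simps)
  ultimately show ?thesis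
    by (simp only:)
qed

section \<open>The scalar functions entering the equation and their derivatives\<close>

text \<open>\<open>U s\<close> is half of the component \<open>u_s\<close>. The others are
  \<open>w_s\<close>, \<open>p\<close> and \<open>q\<close> as functions of \<open>x\<close> and
  \<open>t\<close>.\<close>

definition "U s x t = sandwich N (G x t) (b s x t) (\<lambda>i. cnj (e x t i))"
definition "W s x t = sandwich N (G x t) (b s x t) (\<lambda>i. cnj (e x t i) / (cnj (lam i))\<^sup>2)"
definition "P x t = 1 + 2 * sandwich N (G x t) (\<lambda>i. e x t i / lam i) (\<lambda>i. cnj (e x t i))"
definition "Q x t = sandwich N (G x t) (\<lambda>i. lam i * e x t i) (\<lambda>i. cnj (e x t i) / (cnj (lam i))\<^sup>2)"

lemma U_x:
  assumes det: "det (Mmat N \<sigma> lam c x t) \<noteq> 0"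
  shows "((\<lambda>\<xi>. U s \<xi> t) has_vector_derivative - 2 * \<i> * W s x t * P x t) (at x)"
proof -
  interpret fl_algebra N \<sigma> lam "e x t" "b 1 x t" "b 2 x t" "G x t"
    using det by (rule fl_algebra_at)
  have b: "((\<lambda>\<xi>. b s \<xi> t i) has_vector_derivative - \<i> * (b s x t i / (lam i)\<^sup>2)) (at x)" if "i < N" for i
    using b_x [of s t i x] by simp
  have e: "((\<lambda>\<xi>. cnj (e \<xi> t i)) has_vector_derivative - \<i> * (E i / (cnj (lam i))\<^sup>2)) (at x)" if "i < N" for i
    using has_vector_derivative_cnj [OF e_x [of t i x]] by simp
  have "F (\<lambda>i. b s x t i / (lam i)\<^sup>2) E - F (b s x t) (\<lambda>i. E i / (cnj (lam i))\<^sup>2)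
      = 2 * F (b s x t) (\<lambda>i. E i / (cnj (lam i))\<^sup>2) * F (\<lambda>i. e x t i / lam i) E
      - 2 * (F (b s x t) (\<lambda>i. B1 i / cnj (lam i)) * F (\<lambda>i. b 1 x t i / (lam i)\<^sup>2) E
       + \<sigma> * F (b s x t) (\<lambda>i. B2 i / cnj (lam i)) * F (\<lambda>i. b 2 x t i / (lam i)\<^sup>2) E)"
    by (rule sylvester_inv_sq) auto
  \<comment> \<open>Solving for the form with the weight on the row makes the \<open>b\<close> terms
    cancel against those of the derivative of \<open>M\<close>; what remains is a multiple of
    \<open>W\<close>.\<close>
  then have *: "F (\<lambda>i. b s x t i / (lam i)\<^sup>2) E = F (b s x t) (\<lambda>i. E i / (cnj (lam i))\<^sup>2)
      + 2 * F (b s x t) (\<lambda>i. E i / (cnj (lam i))\<^sup>2) * F (\<lambda>i. e x t i / lam i) E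
      - 2 * (F (b s x t) (\<lambda>i. B1 i / cnj (lam i)) * F (\<lambda>i. b 1 x t i / (lam i)\<^sup>2) E
       + \<sigma> * F (b s x t) (\<lambda>i. B2 i / cnj (lam i)) * F (\<lambda>i. b 2 x t i / (lam i)\<^sup>2) E)"
    by (simp add: diff_eq_eq add.commute add_diff_eq)
  show ?thesis
    unfolding U_def W_def P_def
    by (rule has_vector_derivative_eq_rhs
        [OF sandwich_inv_entry_has_vector_derivative [OF Mmat_carrier det Mmat_x b e, folded G_def]])
      (simp_all add: * algebra_simps)
qed

lemma W_t:
  assumes det: "det (Mmat N \<sigma> lam c x t) \<noteq> 0"
  shows "((\<lambda>\<tau>. W s x \<tau>) has_vector_derivative \<i> / 2 * U s x t * (2 * Q x t - 1)) (at t)"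
proof -
  interpret fl_algebra N \<sigma> lam "e x t" "b 1 x t" "b 2 x t" "G x t"
    using det by (rule fl_algebra_at)
  have b: "((\<lambda>\<tau>. b s x \<tau> i) has_vector_derivative - \<i> / 4 * ((lam i)\<^sup>2 * b s x t i)) (at t)" if "i < N" for i
    using b_t [of s x i t] by (simp add: mult_ac)
  \<comment> \<open>The weight in \<open>W\<close> cancels the rate of the exponential, so the
    derivative of the column is a multiple of \<open>E\<close> and produces
    \<open>U\<close>.\<close>
  have e: "((\<lambda>\<tau>. cnj (e x \<tau> i) / (cnj (lam i))\<^sup>2) has_vector_derivative - \<i> / 4 * E i) (at t)" if "i < N" for i
    using has_vector_derivative_divide [OF has_vector_derivative_cnj [OF e_t [of x i t]], of "(cnj (lam i))\<^sup>2"]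
      lam_nonzero [OF that] by simp
  have "F (b s x t) E - F (\<lambda>i. (lam i)\<^sup>2 * b s x t i) (\<lambda>i. E i / (cnj (lam i))\<^sup>2)
      = 2 * F (b s x t) E * F (\<lambda>i. lam i * e x t i) (\<lambda>i. E i / (cnj (lam i))\<^sup>2)
      - 2 * (F (b s x t) (\<lambda>i. cnj (lam i) * B1 i) * F (b 1 x t) (\<lambda>i. E i / (cnj (lam i))\<^sup>2)
       + \<sigma> * F (b s x t) (\<lambda>i. cnj (lam i) * B2 i) * F (b 2 x t) (\<lambda>i. E i / (cnj (lam i))\<^sup>2))"
    by (rule sylvester_sq) (auto simp: lam_nonzero mult.commute)
  from this [symmetric] have *: "F (\<lambda>i. (lam i)\<^sup>2 * b s x t i) (\<lambda>i. E i / (cnj (lam i))\<^sup>2)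
      = F (b s x t) E - (2 * F (b s x t) E * F (\<lambda>i. lam i * e x t i) (\<lambda>i. E i / (cnj (lam i))\<^sup>2)
      - 2 * (F (b s x t) (\<lambda>i. cnj (lam i) * B1 i) * F (b 1 x t) (\<lambda>i. E i / (cnj (lam i))\<^sup>2)
       + \<sigma> * F (b s x t) (\<lambda>i. cnj (lam i) * B2 i) * F (b 2 x t) (\<lambda>i. E i / (cnj (lam i))\<^sup>2)))"
    by (simp only: diff_diff_eq2 add_diff_cancel_left')
  show ?thesis
    unfolding U_def W_def Q_def
    by (rule has_vector_derivative_eq_rhs
        [OF sandwich_inv_entry_has_vector_derivative [OF Mmat_carrier det Mmat_t b e, folded G_def]])
      (simp_all add: * algebra_simps)
qed

text \<open>After \<open>sylvester_sq\<close> only the \<open>b\<close> terms remain, and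
  \<open>e_b_identity\<close> turns them into squared moduli. The logarithmic derivative is purely
  imaginary, in accordance with \<open>p\<close> having modulus one.\<close>

lemma P_t:
  assumes det: "det (Mmat N \<sigma> lam c x t) \<noteq> 0"
  shows "((\<lambda>\<tau>. P x \<tau>) has_vector_derivative
    - 2 * \<i> * P x t * (U 1 x t * cnj (U 1 x t) + \<sigma> * (U 2 x t * cnj (U 2 x t)))) (at t)"
proof -
  interpret fl_algebra N \<sigma> lam "e x t" "b 1 x t" "b 2 x t" "G x t"
    using det by (rule fl_algebra_at)
  let ?f = "\<lambda>i. e x t i / lam i"
  have e': "((\<lambda>\<tau>. e x \<tau> i / lam i) has_vector_derivative \<i> / 4 * (lam i * e x t i)) (at t)" if "i < N" for i
    using has_vector_derivative_divide [OF e_t [of x i t], of "lam i"] lam_nonzero [OF that]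
    by (simp add: power2_eq_square mult_ac)
  have e: "((\<lambda>\<tau>. cnj (e x \<tau> i)) has_vector_derivative - \<i> / 4 * (E i * (cnj (lam i))\<^sup>2)) (at t)" if "i < N" for i
    using has_vector_derivative_cnj [OF e_t [of x i t]] by (simp add: mult_ac)
  have "F ?f (\<lambda>i. E i * (cnj (lam i))\<^sup>2) - F (\<lambda>i. lam i * e x t i) E
      = 2 * F ?f E * F (\<lambda>i. lam i * e x t i) E
      - 2 * (F ?f (\<lambda>i. cnj (lam i) * B1 i) * F (b 1 x t) E + \<sigma> * F ?f (\<lambda>i. cnj (lam i) * B2 i) * F (b 2 x t) E)"
    by (rule sylvester_sq) (auto simp: lam_nonzero power2_eq_square mult.commute)
  then have *: "F ?f (\<lambda>i. E i * (cnj (lam i))\<^sup>2) = F (\<lambda>i. lam i * e x t i) E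
      + (2 * F ?f E * F (\<lambda>i. lam i * e x t i) E
      - 2 * (F ?f (\<lambda>i. cnj (lam i) * B1 i) * F (b 1 x t) E + \<sigma> * F ?f (\<lambda>i. cnj (lam i) * B2 i) * F (b 2 x t) E))"
    by (simp only: diff_eq_eq add.commute)
  have "((\<lambda>\<tau>. sandwich N (G x \<tau>) (\<lambda>i. e x \<tau> i / lam i) (\<lambda>i. cnj (e x \<tau> i))) has_vector_derivative
      \<i> * (F ?f (\<lambda>i. cnj (lam i) * B1 i) * F (b 1 x t) E + \<sigma> * F ?f (\<lambda>i. cnj (lam i) * B2 i) * F (b 2 x t) E)) (at t)"
    by (rule has_vector_derivative_eq_rhs
        [OF sandwich_inv_entry_has_vector_derivative [OF Mmat_carrier det Mmat_t e' e, folded G_def]])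
      (simp_all add: * algebra_simps)
  then have "((\<lambda>\<tau>. P x \<tau>) has_vector_derivative 0 + 2 *
      (\<i> * (F ?f (\<lambda>i. cnj (lam i) * B1 i) * F (b 1 x t) E + \<sigma> * F ?f (\<lambda>i. cnj (lam i) * B2 i) * F (b 2 x t) E))) (at t)"
    unfolding P_def
    by (intro has_vector_derivative_add has_vector_derivative_mult_right has_vector_derivative_const)
  then show ?thesis
    unfolding e_b_identity U_def P_def by (simp add: algebra_simps)
qed

section \<open>The solution and the coupled equation\<close>

lemma bright_soliton_x:
  assumes det: "det (Mmat N \<sigma> lam c x t) \<noteq> 0"
  shows "((\<lambda>\<xi>. bright_soliton N \<sigma> lam c s \<xi> t) has_vector_derivative - 4 * \<i> * (W s x t * P x t)) (at x)"
proof -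
  have nonzero: "\<forall>\<^sub>F \<xi> in nhds x. det (Mmat N \<sigma> lam c \<xi> t) \<noteq> 0"
    using Mmat_carrier differentiableI_vector [OF Mmat_x] det by (rule eventually_det_nonzero)
  \<comment> \<open>The determinant formula equals \<open>2 * U s\<close> only where
    \<open>det M\<close> is nonzero; agreement near \<open>x\<close> suffices to transfer the
    derivative.\<close>
  have ev: "\<forall>\<^sub>F \<xi> in nhds x. 2 * U s \<xi> t = bright_soliton N \<sigma> lam c s \<xi> t"
    using nonzero by eventually_elim (simp add: bright_soliton_eq U_def)
  have "((\<lambda>\<xi>. 2 * U s \<xi> t) has_vector_derivative 2 * (- 2 * \<i> * W s x t * P x t)) (at x)"
    by (intro has_vector_derivative_mult_right U_x det)
  then show ?thesis
    using eventually_nhds_x_imp_x [OF ev] eventually_mono [OF ev]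
    by (subst (asm) has_vector_derivative_cong_ev [where g = "\<lambda>\<xi>. bright_soliton N \<sigma> lam c s \<xi> t"])
      (auto simp: mult_ac)
qed

lemma pd_x_bright_soliton:
  assumes "det (Mmat N \<sigma> lam c x t) \<noteq> 0"
  shows "pd_x (bright_soliton N \<sigma> lam c s) x t = - 4 * \<i> * (W s x t * P x t)"
  unfolding pd_x_def using bright_soliton_x [OF assms] by (rule vector_derivative_at)

lemma bright_soliton_xt:
  assumes det: "det (Mmat N \<sigma> lam c x t) \<noteq> 0"
  shows "((\<lambda>\<tau>. pd_x (bright_soliton N \<sigma> lam c s) x \<tau>) has_vector_derivative
    2 * U s x t * (2 * Q x t - 1) * P x t
    - 8 * W s x t * P x t * (U 1 x t * cnj (U 1 x t) + \<sigma> * (U 2 x t * cnj (U 2 x t)))) (at t)"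
proof -
  have nonzero: "\<forall>\<^sub>F \<tau> in nhds t. det (Mmat N \<sigma> lam c x \<tau>) \<noteq> 0"
    using Mmat_carrier differentiableI_vector [OF Mmat_t] det by (rule eventually_det_nonzero)
  \<comment> \<open>The closed form of the \<open>x\<close>-derivative is needed at all times near
    \<open>t\<close>, not just at \<open>t\<close>.\<close>
  have ev: "\<forall>\<^sub>F \<tau> in nhds t. - 4 * \<i> * (W s x \<tau> * P x \<tau>) = pd_x (bright_soliton N \<sigma> lam c s) x \<tau>"
    using nonzero by eventually_elim (simp add: pd_x_bright_soliton)
  have "((\<lambda>\<tau>. - 4 * \<i> * (W s x \<tau> * P x \<tau>)) has_vector_derivative
    2 * U s x t * (2 * Q x t - 1) * P x t
    - 8 * W s x t * P x t * (U 1 x t * cnj (U 1 x t) + \<sigma> * (U 2 x t * cnj (U 2 x t)))) (at t)"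
    by (rule has_vector_derivative_eq_rhs [OF has_vector_derivative_mult_right
          [OF has_vector_derivative_mult [OF W_t [OF det] P_t [OF det]]]]) (simp add: field_simps)
  then show ?thesis
    using eventually_nhds_x_imp_x [OF ev] eventually_mono [OF ev]
    by (subst (asm) has_vector_derivative_cong_ev [where g = "\<lambda>\<tau>. pd_x (bright_soliton N \<sigma> lam c s) x \<tau>"])
      auto
qed

lemma U_W_relation:
  assumes "det (Mmat N \<sigma> lam c x t) \<noteq> 0"
  shows "(2 * Q x t - 1) * P x t + 1
    + 4 * P x t * (cnj (U 1 x t) * W 1 x t + \<sigma> * (cnj (U 2 x t) * W 2 x t)) = 0"
  unfolding Q_def P_def U_def W_def
  by (rule fl_algebra.u_w_identity [OF fl_algebra_at [OF assms]])

lemma bright_soliton_solves: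
  "solves_coupled_FL \<sigma> {(x, t). det (Mmat N \<sigma> lam c x t) \<noteq> 0}
     (bright_soliton N \<sigma> lam c 1) (bright_soliton N \<sigma> lam c 2)"
  unfolding solves_coupled_FL_def
proof (intro ballI, clarify)
  fix x t
  assume det: "det (Mmat N \<sigma> lam c x t) \<noteq> 0"
  have diff: "has_pd_x_xt (bright_soliton N \<sigma> lam c s) x t" for s
    using bright_soliton_x [OF det] bright_soliton_xt [OF det]
    unfolding has_pd_x_xt_def by (blast intro: differentiableI_vector)
  have u: "bright_soliton N \<sigma> lam c s x t = 2 * U s x t" for s
    by (simp add: bright_soliton_eq det U_def)
  have ux: "pd_x (bright_soliton N \<sigma> lam c s) x t = - 4 * \<i> * (W s x t * P x t)" for s
    using det by (rule pd_x_bright_soliton)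
  have uxt: "pd_t (pd_x (bright_soliton N \<sigma> lam c s)) x t = 2 * U s x t * (2 * Q x t - 1) * P x t
    - 8 * W s x t * P x t * (U 1 x t * cnj (U 1 x t) + \<sigma> * (U 2 x t * cnj (U 2 x t)))" for s
    unfolding pd_t_def using bright_soliton_xt [OF det] by (rule vector_derivative_at)
  have norm: "complex_of_real ((cmod (2 * z))\<^sup>2) = 4 * (z * cnj z)" for z
    by (simp only: complex_norm_square) simp
  \<comment> \<open>Each left-hand side factors as \<open>2 * U s x t * ?R\<close>: the cubic terms
    of the mixed derivative partly cancel against those with squared moduli, and
    \<open>U_W_relation\<close> makes \<open>?R\<close> vanish.\<close>
  let ?R = "(2 * Q x t - 1) * P x t + 1
    + 4 * P x t * (cnj (U 1 x t) * W 1 x t + \<sigma> * (cnj (U 2 x t) * W 2 x t))"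
  have eq1: "pd_t (pd_x (bright_soliton N \<sigma> lam c 1)) x t + bright_soliton N \<sigma> lam c 1 x t
       + \<i> * of_real ((cmod (bright_soliton N \<sigma> lam c 1 x t))\<^sup>2
           + 1/2 * \<sigma> * (cmod (bright_soliton N \<sigma> lam c 2 x t))\<^sup>2) * pd_x (bright_soliton N \<sigma> lam c 1) x t
       + \<i> / 2 * of_real \<sigma> * bright_soliton N \<sigma> lam c 1 x t * cnj (bright_soliton N \<sigma> lam c 2 x t)
           * pd_x (bright_soliton N \<sigma> lam c 2) x t = 2 * U 1 x t * ?R"
    unfolding u ux uxt of_real_add of_real_mult norm by (simp add: algebra_simps)
  have eq2: "pd_t (pd_x (bright_soliton N \<sigma> lam c 2)) x t + bright_soliton N \<sigma> lam c 2 x t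
       + \<i> * of_real (\<sigma> * (cmod (bright_soliton N \<sigma> lam c 2 x t))\<^sup>2
           + 1/2 * (cmod (bright_soliton N \<sigma> lam c 1 x t))\<^sup>2) * pd_x (bright_soliton N \<sigma> lam c 2) x t
       + \<i> / 2 * bright_soliton N \<sigma> lam c 2 x t * cnj (bright_soliton N \<sigma> lam c 1 x t)
           * pd_x (bright_soliton N \<sigma> lam c 1) x t = 2 * U 2 x t * ?R"
    unfolding u ux uxt of_real_add of_real_mult norm by (simp add: algebra_simps)
  show "has_pd_x_xt (bright_soliton N \<sigma> lam c 1) x t \<and> has_pd_x_xt (bright_soliton N \<sigma> lam c 2) x t \<and>
    pd_t (pd_x (bright_soliton N \<sigma> lam c 1)) x t + bright_soliton N \<sigma> lam c 1 x t
       + \<i> * of_real ((cmod (bright_soliton N \<sigma> lam c 1 x t))\<^sup>2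
           + 1/2 * \<sigma> * (cmod (bright_soliton N \<sigma> lam c 2 x t))\<^sup>2) * pd_x (bright_soliton N \<sigma> lam c 1) x t
       + \<i> / 2 * of_real \<sigma> * bright_soliton N \<sigma> lam c 1 x t * cnj (bright_soliton N \<sigma> lam c 2 x t)
           * pd_x (bright_soliton N \<sigma> lam c 2) x t = 0 \<and>
    pd_t (pd_x (bright_soliton N \<sigma> lam c 2)) x t + bright_soliton N \<sigma> lam c 2 x t
       + \<i> * of_real (\<sigma> * (cmod (bright_soliton N \<sigma> lam c 2 x t))\<^sup>2
           + 1/2 * (cmod (bright_soliton N \<sigma> lam c 1 x t))\<^sup>2) * pd_x (bright_soliton N \<sigma> lam c 2) x t
       + \<i> / 2 * bright_soliton N \<sigma> lam c 2 x t * cnj (bright_soliton N \<sigma> lam c 1 x t)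
           * pd_x (bright_soliton N \<sigma> lam c 1) x t = 0"
    unfolding eq1 eq2 U_W_relation [OF det] using diff by simp
qed

end

theorem mainTheorem5:
  fixes N :: nat and \<sigma> :: real and lam :: "nat \<Rightarrow> complex" and c :: "nat \<Rightarrow> nat \<Rightarrow> complex"
  assumes "N \<ge> 1"
    and "\<sigma> = 1 \<or> \<sigma> = -1"
    and "\<And>i. i < N \<Longrightarrow> lam i \<notin> \<real> \<union> (\<lambda>r. \<i> * r) ` \<real>"
    and "\<And>i j. i < N \<Longrightarrow> j < N \<Longrightarrow> i \<noteq> j \<Longrightarrow> (lam i)\<^sup>2 \<noteq> (lam j)\<^sup>2"
    and "\<And>i. i < N \<Longrightarrow> Im (zpar lam i) < 0"
  shows "solves_coupled_FL \<sigma> {(x, t). det (Mmat N \<sigma> lam c x t) \<noteq> 0}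
           (bright_soliton N \<sigma> lam c 1) (bright_soliton N \<sigma> lam c 2)"
proof -
  interpret fl_soliton N \<sigma> lam c
    by unfold_locales (rule assms(5))
  show ?thesis
    by (rule bright_soliton_solves)
qed

end
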